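(* Let $n>1$ be an integer, let $V=\{v\in\{-1,1\}^n : v_1=1\}$, and for a real number $M$ let $K_M=\{(x_1,\dots,x_n)\in\mathbb{R}^n : x_i\le M \text{ for all } i\in[n]\}$. Consider the balancing game $G(V,K_M)$. Then: (1) If $n$ is odd, Chooser has a winning strategy if and only if $M\ge 2^{n-2}-\frac12\binom{n-1}{(n-1)/2}$. (2) If $n$ is even and not a power of $2$, Chooser has a winning strategy if and only if $M\ge 2^{n-2}-\frac12\binom{n-1}{n/2}$. (3) If $n$ is a power of $2$, Chooser has a winning strategy if and only if $M\ge 2^{n-2}-\frac12\binom{n-1}{n/2}+\frac12$. In each case the critical value of $M$ is $2^{n-2}(1-O(n^{-1/2}))$.
   Context: For a set $V\subset\mathbb{R}^n$ and a convex set $K\subseteq\mathbb{R}^n$, the balancing game $G(V,K)$ is a perfect-information game between Pusher and Chooser producing a sequence of points $z_0=0,z_1,z_2,\dots\in\mathbb{R}^n$: in round $k$, Pusher offers a vector $v_k\in V$, Chooser selects $\varepsilon_k\in\{-1,1\}$, and the next position is $z_{k+1}=z_k+\varepsilon_k v_k$. Pusher wins if at some point $z_k\notin K$; Chooser wins if she can keep $z_k\in K$ for all $k$. *)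

theory Defs
  imports Complex_Main "HOL-Library.Landau_Symbols"
begin

text \<open>Vectors of R^n are represented as functions nat => real whose coordinates
  0,...,n-1 are the n coordinates (coordinate 0 corresponds to x_1); coordinates
  at index >= n are 0 for all vectors in V and are irrelevant for K.\<close>

text \<open>Positions of the balancing game: Chooser's strategy sigma maps the history
  of Pusher's offered vectors (before round k) and the currently offered vector
  to a sign in {-1,1}; vs is the sequence of offered vectors.\<close>
fun game_pos :: "((nat \<Rightarrow> real) list \<Rightarrow> (nat \<Rightarrow> real) \<Rightarrow> real)
    \<Rightarrow> (nat \<Rightarrow> (nat \<Rightarrow> real)) \<Rightarrow> nat \<Rightarrow> (nat \<Rightarrow> real)" where
  "game_pos \<sigma> vs 0 = (\<lambda>i. 0)"
| "game_pos \<sigma> vs (Suc k) =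
     (\<lambda>i. game_pos \<sigma> vs k i + \<sigma> (map vs [0..<k]) (vs k) * vs k i)"

text \<open>Chooser has a winning strategy in G(V,K): a strategy keeping every position
  in K against every sequence of offers from V (against a fixed deterministic
  Chooser strategy, every Pusher strategy amounts to such a sequence).\<close>
definition chooser_wins :: "(nat \<Rightarrow> real) set \<Rightarrow> (nat \<Rightarrow> real) set \<Rightarrow> bool" where
  "chooser_wins V K \<longleftrightarrow>
     (\<exists>\<sigma>. (\<forall>h v. \<sigma> h v \<in> {-1, 1}) \<and>
          (\<forall>vs. (\<forall>k. vs k \<in> V) \<longrightarrow> (\<forall>k. game_pos \<sigma> vs k \<in> K)))"

definition Vset :: "nat \<Rightarrow> (nat \<Rightarrow> real) set" where
  "Vset n = {v. (\<forall>i<n. v i \<in> {-1, 1}) \<and> (\<forall>i\<ge>n. v i = 0) \<and> v 0 = 1}"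

definition Kset :: "nat \<Rightarrow> real \<Rightarrow> (nat \<Rightarrow> real) set" where
  "Kset n M = {x. \<forall>i<n. x i \<le> M}"

definition crit :: "nat \<Rightarrow> real" where
  "crit n = (if odd n then 2 ^ (n - 2) - (n - 1 choose ((n - 1) div 2)) / 2
             else if (\<exists>k. n = 2 ^ k) then 2 ^ (n - 2) - (n - 1 choose (n div 2)) / 2 + 1 / 2
             else 2 ^ (n - 2) - (n - 1 choose (n div 2)) / 2)"

end

theory Submission
  imports Defs "HOL-Library.Nat_Bijection"
begin

text \<open>
  Identify a vector with its set of +1 coordinates, so that an offer is a pair of complementary
  subsets of \<open>{..<n}\<close>.

  Chooser maintains a family \<open>F\<close> containing exactly one set of each complementary pair and answers an
  offer by flipping that pair in \<open>F\<close>. Then the position is half the difference of the sums of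
  \<open>chi A\<close> over the current and the initial family, so its \<open>i\<close>-th coordinate is at most
  \<open>2 ^ (n - 2)\<close> minus half the \<open>i\<close>-th coordinate of the initial sum. Taking all sets of more than
  half size, together with an evenly distributed choice among the half-size sets, makes the initial
  sum as large as possible in every coordinate.

  For the converse, consider the set \<open>W\<close> of positions reachable under a winning strategy and a
  positive weight \<open>w\<close> with distinct subset sums. The support function of \<open>W\<close> has a kink of size at
  least \<open>chi A\<close> across each hyperplane orthogonal to \<open>chi A\<close>, because the face of \<open>W\<close> there is
  invariant under a move by \<open>\<plusminus>chi A\<close>. Following the weight from \<open>w\<close> in direction \<open>e\<^sub>i\<close> and counting
  the kinks bounds the \<open>i\<close>-th coordinate of a \<open>w\<close>-maximal position; comparing with the position 0
  and letting \<open>w\<close> tend to the all-ones direction gives the bound. For \<open>n\<close> a power of 2 the binomial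
  coefficient is odd, and integrality of the positions accounts for the extra \<open>1 / 2\<close>.
\<close>

section \<open>Transversals of complementary pairs\<close>

definition chi :: "nat set \<Rightarrow> nat \<Rightarrow> int" where
  "chi A i = (if i \<in> A then 1 else - 1)"

text \<open>Relative to an arbitrary \<open>U\<close> because two instances occur: all subsets of
  \<open>{..<n}\<close>, which serve as Chooser's state, and the half-size sets, where the balancing
  takes place.\<close>

definition transversal :: "nat \<Rightarrow> nat set set \<Rightarrow> nat set set \<Rightarrow> bool" where
  "transversal n U F \<longleftrightarrow> F \<subseteq> U \<and> (\<forall>A\<in>U. A \<in> F \<longleftrightarrow> {..<n} - A \<notin> F)"

definition compl_closed :: "nat \<Rightarrow> nat set set \<Rightarrow> bool" where
  "compl_closed n U \<longleftrightarrow> U \<subseteq> Pow {..<n} \<and> (\<forall>A\<in>U. {..<n} - A \<in> U)"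

lemma double_compl: "A \<subseteq> {..<n} \<Longrightarrow> {..<n} - ({..<n} - A) = (A :: nat set)"
  by auto

lemma chi_compl: "i < n \<Longrightarrow> chi ({..<n} - A) i = - chi A i"
  by (simp add: chi_def)

lemma sum_chi: "A \<subseteq> {..<n} \<Longrightarrow> (\<Sum>i<n. chi A i) = 2 * int (card A) - int n"
proof -
  assume A: "A \<subseteq> {..<n}"
  have "(\<Sum>i<n. chi A i) = (\<Sum>i<n. 2 * (if i \<in> A then 1 else 0) - 1)"
    by (intro sum.cong) (auto simp: chi_def)
  also have "\<dots> = 2 * (\<Sum>i<n. if i \<in> A then 1 else 0) - int n"
    by (simp add: sum_subtractf sum_distrib_left)
  also have "(\<Sum>i<n. if i \<in> A then 1 else 0 :: int) = int (card ({..<n} \<inter> A))"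
    by (simp add: sum.If_cases)
  also have "{..<n} \<inter> A = A" using A by auto
  finally show ?thesis .
qed

lemma compl_closed_finite: "compl_closed n U \<Longrightarrow> finite U"
  by (auto simp: compl_closed_def intro: finite_subset)

lemma transversal_finite: "compl_closed n U \<Longrightarrow> transversal n U F \<Longrightarrow> finite F"
  by (auto simp: transversal_def dest: compl_closed_finite intro: finite_subset)

text \<open>Complementation is injective and maps \<open>F\<close> onto the rest of
  \<open>U\<close>.\<close>

lemma transversal_card:
  assumes U: "compl_closed n U" and F: "transversal n U F"
  shows "2 * card F = card U"
proof -
  let ?c = "\<lambda>A. {..<n} - A"
  have sub: "F \<subseteq> Pow {..<n}" using U F by (auto simp: compl_closed_def transversal_def)
  have "inj_on ?c F" using sub by (intro inj_onI) (metis PowD double_compl subsetD)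
  then have "card (?c ` F) = card F" by (rule card_image)
  moreover have "U = F \<union> ?c ` F"
  proof
    show "U \<subseteq> F \<union> ?c ` F"
    proof
      fix A assume A: "A \<in> U"
      then have "A = ?c (?c A)" using U by (auto simp: compl_closed_def)
      then show "A \<in> F \<union> ?c ` F" using F A by (auto simp: transversal_def)
    qed
    show "F \<union> ?c ` F \<subseteq> U" using U F by (auto simp: compl_closed_def transversal_def)
  qed
  moreover have "F \<inter> ?c ` F = {}"
  proof -
    have "?c A \<notin> F" if "A \<in> F" for A using F that by (auto simp: transversal_def)
    then show ?thesis by auto
  qed
  moreover have "finite F" using U F by (rule transversal_finite)
  ultimately show ?thesis by (simp add: card_Un_disjoint)
qed

text \<open>The basic move on transversals. For \<open>f\<close> the \<open>i\<close>-th coordinate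
  of \<open>chi\<close> with \<open>i < n\<close>, the sum drops by
  \<open>2 * chi A i\<close>.\<close>

lemma transversal_flip:
  assumes U: "compl_closed n U" and F: "transversal n U F" and A: "A \<in> F"
  shows "transversal n U (insert ({..<n} - A) (F - {A}))"
    and "(\<Sum>B\<in>insert ({..<n} - A) (F - {A}). f B) = (\<Sum>B\<in>F. f B) - f A + (f ({..<n} - A) :: int)"
proof -
  let ?c = "\<lambda>A. {..<n} - A"
  have AU: "A \<in> U" "?c A \<in> U" "A \<subseteq> {..<n}" using U F A by (auto simp: compl_closed_def transversal_def)
  have cA: "?c A \<notin> F" using F A AU by (auto simp: transversal_def)
  show "transversal n U (insert (?c A) (F - {A}))"
    unfolding transversal_def
  proof (intro conjI ballI)
    show "insert (?c A) (F - {A}) \<subseteq> U" using F AU by (auto simp: transversal_def)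
    fix B assume B: "B \<in> U"
    then have Bs: "B \<subseteq> {..<n}" using U by (auto simp: compl_closed_def)
    have "B \<in> F \<longleftrightarrow> ?c B \<notin> F" using F B by (auto simp: transversal_def)
    moreover have "?c B = A \<longleftrightarrow> B = ?c A" "?c B = ?c A \<longleftrightarrow> B = A"
      using Bs AU by auto
    moreover have "A \<noteq> ?c A" using A cA by metis
    ultimately show "B \<in> insert (?c A) (F - {A}) \<longleftrightarrow> ?c B \<notin> insert (?c A) (F - {A})"
      using A cA by auto
  qed
  have "finite F" using U F by (rule transversal_finite)
  then show "(\<Sum>B\<in>insert (?c A) (F - {A}). f B) = (\<Sum>B\<in>F. f B) - f A + f (?c A)"
    using cA A by (simp add: sum_diff1)
qed

lemma card_subsets_avoiding:
  assumes "i < n"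
  shows "card {X. X \<subseteq> {..<n} - {i} \<and> card X = k} = (n - 1) choose k"
  using n_subsets[of "{..<n} - {i}" k] assms by simp

text \<open>Pair each \<open>A\<close> avoiding \<open>i\<close> with \<open>insert i A\<close>. If
  \<open>A\<close> is already a strict majority, the two contributions cancel; a surplus of 1
  remains exactly when adding \<open>i\<close> creates the majority, that is when
  \<open>card A = n div 2\<close>.\<close>

lemma sum_chi_majority:
  assumes i: "i < n"
  shows "(\<Sum>A | A \<subseteq> {..<n} \<and> n < 2 * card A. chi A i) = int ((n - 1) choose (n div 2))"
proof -
  let ?P = "Pow ({..<n} - {i})"
  let ?g = "\<lambda>A. if n < 2 * card A then chi A i else 0"
  have split: "Pow {..<n} = ?P \<union> insert i ` ?P"
    using Pow_insert[of i "{..<n} - {i}"] i by (simp add: insert_absorb)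
  have fin: "finite X" if "X \<in> ?P" for X using that finite_subset by auto
  have "(\<Sum>A | A \<subseteq> {..<n} \<and> n < 2 * card A. chi A i) = (\<Sum>A\<in>Pow {..<n}. ?g A)"
    by (subst sum.inter_filter[symmetric]) (auto intro!: sum.cong)
  also have "\<dots> = (\<Sum>A\<in>?P. ?g A) + (\<Sum>A\<in>insert i ` ?P. ?g A)"
    unfolding split by (rule sum.union_disjoint) auto
  also have "(\<Sum>A\<in>insert i ` ?P. ?g A) = (\<Sum>A\<in>?P. ?g (insert i A))"
    by (subst sum.reindex) (auto simp: inj_on_def)
  also have "(\<Sum>A\<in>?P. ?g A) + (\<Sum>A\<in>?P. ?g (insert i A)) = (\<Sum>A\<in>?P. if card A = n div 2 then 1 else 0)"
    unfolding sum.distrib[symmetric]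
  proof (intro sum.cong refl)
    fix A assume A: "A \<in> ?P"
    then have "card (insert i A) = Suc (card A)" using fin by (subst card_insert_disjoint) auto
    then show "?g A + ?g (insert i A) = (if card A = n div 2 then 1 else 0)"
      using A by (auto simp: chi_def)
  qed
  also have "\<dots> = int (card {X. X \<subseteq> {..<n} - {i} \<and> card X = n div 2})"
    by (simp add: sum.If_cases Int_def)
  finally show ?thesis using card_subsets_avoiding[OF i] by simp
qed

section \<open>Balanced families of half-size sets\<close>

text \<open>Written with \<open>2 * card A = n\<close> instead of \<open>n div 2\<close>, so that
  the family is empty for odd \<open>n\<close> and both parities can be treated together
  later.\<close>

definition halves :: "nat \<Rightarrow> nat set set" where
  "halves n = {A. A \<subseteq> {..<n} \<and> 2 * card A = n}"

lemma card_compl: "A \<subseteq> {..<n} \<Longrightarrow> card ({..<n} - A) = n - card A"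
  by (simp add: card_Diff_subset finite_subset)

lemma compl_closed_halves: "compl_closed n (halves n)"
  by (auto simp: compl_closed_def halves_def card_compl)

lemma card_halves: "n > 0 \<Longrightarrow> even n \<Longrightarrow> card (halves n) = 2 * ((n - 1) choose (n div 2))"
proof -
  assume n: "n > 0" "even n"
  then obtain m where m: "n = 2 * m" by auto
  have "halves n = {A. A \<subseteq> {..<n} \<and> card A = m}" by (auto simp: halves_def m)
  then have "card (halves n) = n choose m" by (simp add: n_subsets)
  also obtain k where k: "m = Suc k" using n m by (cases m) auto
  have "n choose m = (2 * k + 1 choose k) + (2 * k + 1 choose Suc k)" by (simp add: m k)
  also have "(2 * k + 1 choose k) = (2 * k + 1 choose Suc k)"
    using binomial_symmetric[of k "2 * k + 1"] by simp
  finally show ?thesis by (simp add: m k)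
qed

lemma chi_sum_eq_card:
  assumes "finite F"
  shows "(\<Sum>A\<in>F. chi A i) = 2 * int (card {A\<in>F. i \<in> A}) - int (card F)"
proof -
  have "(\<Sum>A\<in>F. chi A i) = (\<Sum>A\<in>F. 2 * (if i \<in> A then 1 else 0) - 1)"
    by (intro sum.cong) (auto simp: chi_def)
  also have "\<dots> = 2 * (\<Sum>A\<in>F. if i \<in> A then 1 else 0) - int (card F)"
    by (simp add: sum_subtractf sum_distrib_left)
  also have "(\<Sum>A\<in>F. if i \<in> A then 1 else 0 :: int) = int (card {A\<in>F. i \<in> A})"
    using assms by (simp add: sum.If_cases Int_def)
  finally show ?thesis .
qed

text \<open>Sets that contain both or neither of \<open>i\<close> and \<open>j\<close> contribute
  equally to the two sums and cancel.\<close>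

lemma chi_sum_diff:
  assumes "finite F"
  shows "(\<Sum>A\<in>F. chi A i) - (\<Sum>A\<in>F. chi A j) =
    2 * int (card {A\<in>F. i \<in> A \<and> j \<notin> A}) - 2 * int (card {A\<in>F. j \<in> A \<and> i \<notin> A})"
proof -
  have "card {A\<in>F. i \<in> A} = card {A\<in>F. i \<in> A \<and> j \<notin> A} + card {A\<in>F. i \<in> A \<and> j \<in> A}" for i j
    using assms by (subst card_Un_disjoint[symmetric]) (auto intro!: arg_cong[where f = card])
  from this[of i j] this[of j i] show ?thesis
    using assms by (simp add: chi_sum_eq_card conj_commute)
qed

text \<open>The number is the central binomial coefficient of \<open>n - 2\<close>.\<close>

lemma card_separating_even:
  assumes n: "n > 2" "even n" and ij: "i < n" "j < n" "i \<noteq> j"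
  shows "even (card {A\<in>halves n. i \<in> A \<and> j \<notin> A})"
proof -
  obtain m where "n = 2 * m" using n by auto
  then have k: "n = 2 * (m - 2) + 4" using n by simp
  define k where "k = m - 2"
  note k = k[folded k_def]
  let ?R = "{..<n} - {i} - {j}"
  let ?S = "{X. X \<subseteq> ?R \<and> card X = k + 1}"
  have eq: "{A\<in>halves n. i \<in> A \<and> j \<notin> A} = insert i ` ?S"
  proof
    show "insert i ` ?S \<subseteq> {A\<in>halves n. i \<in> A \<and> j \<notin> A}"
    proof
      fix A assume "A \<in> insert i ` ?S"
      then obtain X where X: "A = insert i X" "X \<subseteq> ?R" "card X = k + 1" by auto
      then have "finite X" using finite_subset by blast
      then have "card A = k + 2" using X by (auto simp: card_insert_if)
      then show "A \<in> {A\<in>halves n. i \<in> A \<and> j \<notin> A}" using X ij k by (auto simp: halves_def)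
    qed
    show "{A\<in>halves n. i \<in> A \<and> j \<notin> A} \<subseteq> insert i ` ?S"
    proof
      fix A assume A: "A \<in> {A\<in>halves n. i \<in> A \<and> j \<notin> A}"
      then have "A = insert i (A - {i})" "A - {i} \<subseteq> ?R" "card (A - {i}) = k + 1"
        using k by (auto simp: halves_def)
      then show "A \<in> insert i ` ?S" by blast
    qed
  qed
  have "card {A\<in>halves n. i \<in> A \<and> j \<notin> A} = card ?S"
    unfolding eq by (intro card_image inj_onI) (auto simp: insert_eq_iff)
  also have "\<dots> = card ?R choose (k + 1)" by (rule n_subsets) auto
  also have "card ?R = 2 * k + 2" using ij k by simp
  also have "2 * k + 2 choose (k + 1) = (2 * k + 1 choose k) + (2 * k + 1 choose Suc k)" by simp
  also have "(2 * k + 1 choose k) = (2 * k + 1 choose Suc k)"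
    using binomial_symmetric[of k "2 * k + 1"] by simp
  finally show ?thesis by simp
qed

text \<open>An even number of half-size sets contain \<open>i\<close> but not \<open>j\<close>, and
  for each of them either the set or its complement is in \<open>F\<close>. So the two kinds of
  separating sets in \<open>F\<close> have an even total, hence an even difference, and the
  coordinates differ by twice that.\<close>

lemma transversal_chi_cong:
  assumes n: "n > 2" "even n" and ij: "i < n" "j < n" and F: "transversal n (halves n) F"
  shows "4 dvd (\<Sum>A\<in>F. chi A i) - (\<Sum>A\<in>F. chi A j)"
proof (cases "i = j")
  case False
  let ?c = "\<lambda>A. {..<n} - A"
  let ?P = "{A\<in>F. i \<in> A \<and> j \<notin> A}" and ?Q = "{A\<in>F. j \<in> A \<and> i \<notin> A}"
  have finF: "finite F" using compl_closed_halves F by (rule transversal_finite)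
  have FH: "F \<subseteq> halves n" using F by (simp add: transversal_def)
  have sub: "A \<subseteq> {..<n}" if "A \<in> F" for A using that FH by (auto simp: halves_def)
  have eq: "{A\<in>halves n. i \<in> A \<and> j \<notin> A} = ?P \<union> ?c ` ?Q"
  proof
    show "{A\<in>halves n. i \<in> A \<and> j \<notin> A} \<subseteq> ?P \<union> ?c ` ?Q"
    proof
      fix A assume A: "A \<in> {A\<in>halves n. i \<in> A \<and> j \<notin> A}"
      then have "A = ?c (?c A)" by (auto simp: halves_def)
      moreover have "A \<in> F \<or> ?c A \<in> F" using A F by (auto simp: transversal_def)
      ultimately show "A \<in> ?P \<union> ?c ` ?Q" using A ij by (cases "A \<in> F") auto
    qed
    show "?P \<union> ?c ` ?Q \<subseteq> {A\<in>halves n. i \<in> A \<and> j \<notin> A}"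
      using FH compl_closed_halves[of n] ij by (auto simp: compl_closed_def)
  qed
  have disj: "?P \<inter> ?c ` ?Q = {}"
  proof -
    have "?c A \<notin> F" if "A \<in> F" for A using F that by (auto simp: transversal_def)
    then show ?thesis by auto
  qed
  have "inj_on ?c ?Q" by (intro inj_onI) (metis (no_types, lifting) mem_Collect_eq double_compl sub)
  then have "card (?c ` ?Q) = card ?Q" by (rule card_image)
  then have "even (card ?P + card ?Q)"
    using card_separating_even[OF n ij False] disj finF unfolding eq by (simp add: card_Un_disjoint)
  then have "even (int (card ?P) - int (card ?Q))" by simp
  then obtain q where "int (card ?P) - int (card ?Q) = 2 * q" by (rule evenE)
  then have "(\<Sum>A\<in>F. chi A i) - (\<Sum>A\<in>F. chi A j) = 4 * q"
    unfolding chi_sum_diff[OF finF] by linarith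
  then show ?thesis by simp
qed simp

text \<open>By counting, some \<open>A\<close> in \<open>F\<close> with \<open>i\<close> but not
  \<open>j\<close> has its exchange \<open>insert j (A - {i})\<close> outside \<open>F\<close>, so
  the complement \<open>B\<close> of the exchange is in \<open>F\<close>. Flipping \<open>A\<close>
  and then \<open>B\<close> changes the sum by \<open>- 2 * (chi A + chi B)\<close>, which is
  supported on \<open>i\<close> and \<open>j\<close>.\<close>

lemma transversal_shift:
  assumes n: "n > 2" and ij: "i < n" "j < n" "i \<noteq> j" and F: "transversal n (halves n) F"
    and less: "(\<Sum>A\<in>F. chi A j) < (\<Sum>A\<in>F. chi A i)"
  shows "\<exists>F'. transversal n (halves n) F' \<and>
    (\<forall>l<n. (\<Sum>A\<in>F'. chi A l) = (\<Sum>A\<in>F. chi A l) - (if l = i then 4 else 0) + (if l = j then 4 else 0))"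
proof -
  let ?c = "\<lambda>A. {..<n} - A"
  let ?P = "{A\<in>F. i \<in> A \<and> j \<notin> A}" and ?Q = "{A\<in>F. j \<in> A \<and> i \<notin> A}"
  let ?t = "\<lambda>A. insert j (A - {i})"
  have finF: "finite F" using compl_closed_halves F by (rule transversal_finite)
  have FH: "F \<subseteq> halves n" using F by (simp add: transversal_def)
  have "card ?Q < card ?P" using less chi_sum_diff[OF finF, of i j] by linarith
  moreover have inj: "inj_on ?t ?P"
    by (rule inj_on_inverseI[where g = "\<lambda>B. insert i (B - {j})"]) auto
  ultimately have "card ?Q < card (?t ` ?P)" by (simp only: card_image)
  moreover have "finite ?Q" using finF by simp
  ultimately have "\<not> ?t ` ?P \<subseteq> ?Q" by (meson card_mono leD)
  then obtain A where A': "A \<in> ?P" "?t A \<notin> ?Q" unfolding image_subset_iff by blast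
  then have A: "A \<in> F" "i \<in> A" "j \<notin> A" by simp_all
  then have tA: "?t A \<notin> F" using A'(2) ij by simp
  have AH: "A \<subseteq> {..<n}" "2 * card A = n" using A FH by (auto simp: halves_def)
  have "finite A" using AH finite_subset by auto
  then have "card (?t A) = card A"
    using A card_Suc_Diff1[of A i] by (simp del: card_Diff_insert card_Diff_singleton)
  then have tH: "?t A \<in> halves n" using AH ij by (auto simp: halves_def)
  define B where "B = ?c (?t A)"
  have B: "B \<in> F" using tH tA F by (auto simp: transversal_def B_def)
  have cB: "?c B = ?t A" using AH ij by (auto simp: B_def)
  define F1 where "F1 = insert (?c A) (F - {A})"
  have F1: "transversal n (halves n) F1" unfolding F1_def
    by (rule transversal_flip(1)[OF compl_closed_halves F A(1)])
  have "i \<in> B" using ij by (auto simp: B_def)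
  have "j \<notin> B" by (auto simp: B_def)
  \<comment> \<open>The second flip needs \<open>B\<close> to survive the first one; equality would
    force \<open>A\<close> to be a singleton, against \<open>n > 2\<close>.\<close>
  have "B \<noteq> A"
  proof
    assume "B = A"
    then have "A = ?c (?t A)" by (simp add: B_def)
    then have "A \<subseteq> {i}" by auto
    then have "card A \<le> 1" using card_mono[of "{i}" A] by simp
    then show False using AH n by simp
  qed
  then have B1: "B \<in> F1" using B by (simp add: F1_def)
  show ?thesis
  proof (intro exI conjI allI impI)
    show "transversal n (halves n) (insert (?c B) (F1 - {B}))"
      by (rule transversal_flip(1)[OF compl_closed_halves F1 B1])
    fix l assume l: "l < n"
    have "(\<Sum>A\<in>insert (?c B) (F1 - {B}). chi A l) = (\<Sum>A\<in>F. chi A l) - 2 * chi A l - 2 * chi B l"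
      using transversal_flip(2)[OF compl_closed_halves F1 B1, of "\<lambda>A. chi A l"]
        transversal_flip(2)[OF compl_closed_halves F A(1), of "\<lambda>A. chi A l", folded F1_def] l
      by (simp add: chi_compl)
    also have "2 * chi A l + 2 * chi B l = (if l = i then 4 else 0) - (if l = j then 4 else 0)"
      using A ij l by (auto simp: chi_def B_def)
    then have "(\<Sum>A\<in>F. chi A l) - 2 * chi A l - 2 * chi B l =
        (\<Sum>A\<in>F. chi A l) - (if l = i then 4 else 0) + (if l = j then 4 else 0)" by linarith
    finally show "(\<Sum>A\<in>insert (?c B) (F1 - {B}). chi A l) =
        (\<Sum>A\<in>F. chi A l) - (if l = i then 4 else 0) + (if l = j then 4 else 0)" .
  qed
qed

lemma transversal_exists:
  assumes "n > 0"
  shows "\<exists>F. transversal n (halves n) F"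
proof
  have "A \<subseteq> {..<n} \<Longrightarrow> 0 \<in> A \<longleftrightarrow> 0 \<notin> {..<n} - A" for A using assms by auto
  then show "transversal n (halves n) {A\<in>halves n. 0 \<in> A}"
    using compl_closed_halves[of n] by (auto simp: transversal_def compl_closed_def halves_def)
qed

text \<open>
  All coordinates of the sum vector agree modulo 4, and flipping one pair moves their common class
  by 2, so the class can be chosen to be that of \<open>- (N mod 2)\<close>. Shifting 4 from a large coordinate
  to a small one then decreases the sum of squares until no coordinate lies below this value.
\<close>

lemma balanced_transversal_gt_2:
  assumes n: "n > 2" "even n"
  defines "N \<equiv> (n - 1) choose (n div 2)"
  shows "\<exists>F. transversal n (halves n) F \<and> (\<forall>i<n. - int (N mod 2) \<le> (\<Sum>A\<in>F. chi A i))"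
proof -
  define d where "d F i = (\<Sum>A\<in>F. chi A i)" for F i
  define c where "c = - int (N mod 2)"
  define ok where "ok F \<longleftrightarrow> transversal n (halves n) F \<and> 4 dvd d F 0 - c" for F
  have cardF: "card F = N" if "transversal n (halves n) F" for F
    using transversal_card[OF compl_closed_halves that] card_halves[of n] n by (simp add: N_def)
  have "\<exists>F. ok F"
  proof -
    obtain F where F: "transversal n (halves n) F" using transversal_exists[of n] n by auto
    have "N > 0" using n by (simp add: N_def)
    then obtain A where A: "A \<in> F" using cardF[OF F] by fastforce
    define F' where "F' = insert ({..<n} - A) (F - {A})"
    have F': "transversal n (halves n) F'"
      unfolding F'_def by (rule transversal_flip(1)[OF compl_closed_halves F A])
    have dF': "d F' 0 = d F 0 - 2 * chi A 0"
      using transversal_flip(2)[OF compl_closed_halves F A, of "\<lambda>A. chi A 0"] n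
      by (simp add: d_def F'_def chi_compl)
    have "finite F" using compl_closed_halves F by (rule transversal_finite)
    then have "d F 0 = 2 * int (card {A\<in>F. 0 \<in> A}) - int N"
      using chi_sum_eq_card cardF[OF F] by (simp add: d_def)
    then have "even (d F 0 - c)" by (simp add: c_def)
    then obtain q where q: "d F 0 - c = 2 * q" by (rule evenE)
    have "4 dvd d F 0 - c \<or> 4 dvd d F' 0 - c"
    proof (cases "even q")
      case True
      then show ?thesis unfolding q by auto
    next
      case False
      then obtain r where "q = 2 * r + 1" by (rule oddE)
      then have "d F' 0 - c = 4 * r \<or> d F' 0 - c = 4 * (r + 1)" using q dF' by (auto simp: chi_def)
      then show ?thesis by (metis dvd_triv_left)
    qed
    then show ?thesis using F F' by (auto simp: ok_def)
  qed
  then obtain F where F: "ok F" and least: "\<And>F'. ok F' \<Longrightarrow>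
      nat (\<Sum>i<n. (d F i)\<^sup>2) \<le> nat (\<Sum>i<n. (d F' i)\<^sup>2)"
    using ex_has_least_nat[of ok _ "\<lambda>F. nat (\<Sum>i<n. (d F i)\<^sup>2)"] by auto
  have T: "transversal n (halves n) F" using F by (simp add: ok_def)
  have cong: "4 dvd d F i - c" if "i < n" for i
    using transversal_chi_cong[OF n that _ T, of 0] F n dvd_add[of 4 "d F i - d F 0" "d F 0 - c"]
    by (simp add: ok_def d_def)
  have "c \<le> d F j" if j: "j < n" for j
  proof (rule ccontr)
    assume "\<not> c \<le> d F j"
    then have dj: "d F j \<le> c - 4" using cong[OF j] by presburger
    have c01: "c \<le> 0" "-1 \<le> c" by (auto simp: c_def)
    have "(\<Sum>i<n. d F i) = (\<Sum>A\<in>F. \<Sum>i<n. chi A i)" unfolding d_def by (rule sum.swap)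
    also have "\<dots> = 0"
      using T by (intro sum.neutral) (auto simp: transversal_def halves_def sum_chi)
    finally have sum0: "(\<Sum>i<n. d F i) = 0" .
    \<comment> \<open>Half-size sets have coordinate sum 0, so the deficit at \<open>j\<close> must
      be compensated elsewhere.\<close>
    have "\<exists>i<n. d F i > 0"
    proof (rule ccontr)
      assume "\<not> (\<exists>i<n. d F i > 0)"
      then have "d F i \<le> 0" if "i < n" for i using that by (metis not_less)
      moreover have "d F j < 0" using dj c01 by simp
      ultimately have "(\<Sum>i<n. d F i) < (\<Sum>i<n. 0)"
        using j by (intro sum_strict_mono_ex1) auto
      then show False using sum0 by simp
    qed
    then obtain i where i: "i < n" "d F i > 0" by auto
    then have di: "d F i \<ge> c + 4" using cong[OF i(1)] c01 by presburger
    then have ij: "i \<noteq> j" using dj by auto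
    obtain F' where F': "transversal n (halves n) F'"
      and dF': "\<And>l. l < n \<Longrightarrow> d F' l = d F l - (if l = i then 4 else 0) + (if l = j then 4 else 0)"
      using transversal_shift[OF n(1) i(1) j ij T] di dj by (auto simp: d_def)
    have "4 dvd d F' 0 - c" using dF'[of 0] n cong[of 0] by (auto split: if_splits) presburger+
    then have "ok F'" using F' by (simp add: ok_def)
    then have le: "(\<Sum>l<n. (d F l)\<^sup>2) \<le> (\<Sum>l<n. (d F' l)\<^sup>2)"
      using least[of F'] sum_nonneg[of "{..<n}" "\<lambda>l. (d F' l)\<^sup>2"] by simp
    have "(\<Sum>l<n. (d F' l)\<^sup>2) =
        (\<Sum>l<n. (d F l)\<^sup>2 + (if l = i then 16 - 8 * d F i else 0) + (if l = j then 16 + 8 * d F j else 0))"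
      using ij by (intro sum.cong refl) (auto simp: dF' power2_eq_square algebra_simps)
    also have "\<dots> = (\<Sum>l<n. (d F l)\<^sup>2) + (16 - 8 * d F i) + (16 + 8 * d F j)"
      using i j by (simp add: sum.distrib)
    \<comment> \<open>The sum of squares changes by \<open>32 - 8 * (d F i - d F j)\<close>. The two
      entries lie at least 4 above and 4 below \<open>c\<close>, so this is at most
      \<open>- 32\<close>, against minimality.\<close>
    finally show False using le di dj by linarith
  qed
  then show ?thesis using T by (auto simp: d_def c_def)
qed

lemma balanced_transversal:
  assumes n: "n > 1" "even n"
  shows "\<exists>F. transversal n (halves n) F \<and>
    (\<forall>i<n. - int (((n - 1) choose (n div 2)) mod 2) \<le> (\<Sum>A\<in>F. chi A i))"
proof (cases "n = 2")
  case True
  obtain F where F: "transversal n (halves n) F" using transversal_exists[of n] n by auto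
  have "card F = 1"
    using transversal_card[OF compl_closed_halves F] card_halves[of n] True by simp
  then obtain A where "F = {A}" by (auto simp: card_1_singleton_iff)
  then have "\<forall>i<n. - int (((n - 1) choose (n div 2)) mod 2) \<le> (\<Sum>A\<in>F. chi A i)"
    using True by (auto simp: chi_def)
  then show ?thesis using F by blast
next
  case False
  then show ?thesis using balanced_transversal_gt_2[of n] n by auto
qed

text \<open>The sets of more than half size contribute \<open>(n - 1) choose (n div 2)\<close> to
  every coordinate; a balanced choice of half-size sets costs at most the parity of that
  number.\<close>

lemma good_transversal:
  assumes n: "n > 1"
  shows "\<exists>F. transversal n (Pow {..<n}) F \<and> (\<forall>i<n. int ((n - 1) choose (n div 2)) -
    (if even n then int (((n - 1) choose (n div 2)) mod 2) else 0) \<le> (\<Sum>A\<in>F. chi A i))"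
proof -
  define G where "G = {A. A \<subseteq> {..<n} \<and> n < 2 * card A}"
  have "\<exists>F. transversal n (halves n) F \<and>
    (\<forall>i<n. - (if even n then int (((n - 1) choose (n div 2)) mod 2) else 0) \<le> (\<Sum>A\<in>F. chi A i))"
  proof (cases "even n")
    case True
    then show ?thesis using balanced_transversal[OF n] by auto
  next
    case False
    then have "halves n = {}" by (auto simp: halves_def)
    then show ?thesis using False by (intro exI[of _ "{}"]) (simp add: transversal_def)
  qed
  then obtain F where F: "transversal n (halves n) F"
    and bal: "\<And>i. i < n \<Longrightarrow>
      - (if even n then int (((n - 1) choose (n div 2)) mod 2) else 0) \<le> (\<Sum>A\<in>F. chi A i)" by blast
  have FH: "F \<subseteq> halves n" using F by (simp add: transversal_def)
  have "transversal n (Pow {..<n}) (G \<union> F)"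
    unfolding transversal_def
  proof (intro conjI ballI)
    show "G \<union> F \<subseteq> Pow {..<n}" using FH by (auto simp: G_def halves_def)
    fix A assume A: "A \<in> Pow {..<n}"
    then have c: "card ({..<n} - A) = n - card A" "card A \<le> n"
      using card_compl card_mono[of "{..<n}" A] by auto
    show "A \<in> G \<union> F \<longleftrightarrow> {..<n} - A \<notin> G \<union> F"
    proof (cases "2 * card A = n")
      case True
      then have "A \<in> F \<longleftrightarrow> {..<n} - A \<notin> F" using F A by (auto simp: transversal_def halves_def)
      then show ?thesis using True c by (auto simp: G_def)
    next
      case False
      then have "A \<notin> F" "{..<n} - A \<notin> F" using FH c by (auto simp: halves_def)
      then show ?thesis using False c A by (auto simp: G_def)
    qed
  qed
  moreover have "int ((n - 1) choose (n div 2)) -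
    (if even n then int (((n - 1) choose (n div 2)) mod 2) else 0) \<le> (\<Sum>A\<in>G \<union> F. chi A i)" if i: "i < n" for i
  proof -
    have "finite G" by (simp add: G_def)
    moreover have "finite F" using compl_closed_halves F by (rule transversal_finite)
    moreover have "G \<inter> F = {}" using FH by (auto simp: G_def halves_def)
    ultimately have "(\<Sum>A\<in>G \<union> F. chi A i) = (\<Sum>A\<in>G. chi A i) + (\<Sum>A\<in>F. chi A i)"
      by (rule sum.union_disjoint)
    then show ?thesis using sum_chi_majority[OF i] bal[OF i] by (simp add: G_def)
  qed
  ultimately show ?thesis by blast
qed

section \<open>Binomial coefficients\<close>

text \<open>The coefficient form of \<open>(1 + x) ^ (2 * a) = (1 + x ^ 2) ^ a\<close> modulo 2,
  obtained from two applications of Pascal's rule.\<close>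

lemma binomial_double_parity:
  "(even (2 * a choose (2 * b)) \<longleftrightarrow> even (a choose b)) \<and> even (2 * a choose (2 * b + 1))"
proof (induction a arbitrary: b)
  case 0
  then show ?case by (cases b) auto
next
  case (Suc a)
  have "2 * Suc a = Suc (Suc (2 * a))" by simp
  then show ?case
    using Suc.IH[of b] Suc.IH[of "b - 1"] by (cases b) auto
qed

lemma binomial_central_even: "b > 0 \<Longrightarrow> even (2 * b choose b)"
proof -
  assume "b > 0"
  then obtain k where k: "b = Suc k" by (cases b) auto
  have "(2 * k + 1 choose k) = (2 * k + 1 choose Suc k)"
    using binomial_symmetric[of k "2 * k + 1"] by simp
  then show ?thesis by (simp add: k)
qed

text \<open>For \<open>m = 2 * b\<close>, Pascal's rule and the doubling parities give the same
  parity as for \<open>b\<close>; for odd \<open>m > 1\<close> both Pascal summands are even. Hence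
  oddness means that repeated halving of \<open>m\<close> ends in 1.\<close>

lemma odd_binomial_iff_power_of_2:
  assumes "m > 0"
  shows "odd ((2 * m - 1) choose m) \<longleftrightarrow> (\<exists>k. 2 * m = 2 ^ k)"
  using assms
proof (induction m rule: less_induct)
  case (less m)
  show ?case
  proof (cases "even m")
    case True
    then obtain b where b: "m = 2 * b" by auto
    then have b0: "b > 0" using less.prems by simp
    obtain c where c: "b = Suc c" using b0 by (cases b) auto
    have "2 * m - 1 = Suc (2 * (2 * b - 1))" "m = Suc (2 * c + 1)" using b b0 c by simp_all
    then have "(2 * m - 1) choose m =
        (2 * (2 * b - 1) choose (2 * c + 1)) + (2 * (2 * b - 1) choose (2 * b))"
      using c by simp
    then have "odd ((2 * m - 1) choose m) \<longleftrightarrow> odd ((2 * b - 1) choose b)"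
      using binomial_double_parity[of "2 * b - 1" b] binomial_double_parity[of "2 * b - 1" c] by simp
    also have "\<dots> \<longleftrightarrow> (\<exists>k. 2 * b = 2 ^ k)" using less.IH[of b] b b0 by simp
    also have "\<dots> \<longleftrightarrow> (\<exists>k. 2 * m = 2 ^ k)"
    proof
      assume "\<exists>k. 2 * b = 2 ^ k"
      then obtain k where "2 * b = 2 ^ k" by auto
      then have "2 * m = 2 ^ Suc k" using b by simp
      then show "\<exists>k. 2 * m = 2 ^ k" by blast
    next
      assume "\<exists>k. 2 * m = 2 ^ k"
      then obtain k where k: "2 * m = 2 ^ k" by auto
      then obtain l where "k = Suc l" using less.prems by (cases k) auto
      then have "2 * b = 2 ^ l" using k b by simp
      then show "\<exists>k. 2 * b = 2 ^ k" by blast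
    qed
    finally show ?thesis .
  next
    case False
    then obtain b where b: "m = 2 * b + 1" by (rule oddE)
    show ?thesis
    proof (cases "b = 0")
      case True
      then show ?thesis using b by (auto intro!: exI[of _ 1])
    next
      case b0: False
      have "(2 * m - 1) choose m = (2 * (2 * b) choose (2 * b)) + (2 * (2 * b) choose (2 * b + 1))"
        by (simp add: b)
      then have "even ((2 * m - 1) choose m)"
        using binomial_double_parity[of "2 * b" b] binomial_central_even[of b] b0 by simp
      moreover have "2 * m \<noteq> 2 ^ k" for k
      proof
        assume k: "2 * m = 2 ^ k"
        then obtain l where "k = Suc l" using less.prems by (cases k) auto
        then have l: "m = 2 ^ l" using k by simp
        then show False using False b b0 by (cases l) auto
      qed
      ultimately show ?thesis by blast
    qed
  qed
qed

section \<open>Growth of middle binomial coefficients\<close>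

lemma central_binomial_bound: "(2 * k choose k)\<^sup>2 * (2 * k + 1) \<le> 16 ^ k"
proof (induction k)
  case (Suc k)
  let ?c = "2 * k choose k" and ?c' = "2 * Suc k choose Suc k"
  have "(2 * k + 1 choose k) = (2 * k + 1 choose Suc k)"
    using binomial_symmetric[of k "2 * k + 1"] by simp
  then have "?c' = 2 * (2 * k + 1 choose Suc k)" by simp
  then have c': "?c' * Suc k = 2 * ((2 * k + 1) * ?c)"
    using Suc_times_binomial_eq[of "2 * k" k] by simp
  \<comment> \<open>The factor \<open>(Suc k)\<^sup>2\<close> avoids division in the recurrence; the
    induction closes because \<open>(2 * k + 1) * (2 * k + 3)\<close> is one less than
    \<open>4 * (Suc k)\<^sup>2\<close>.\<close>
  have "(Suc k)\<^sup>2 * (?c'\<^sup>2 * (2 * Suc k + 1)) = (?c' * Suc k)\<^sup>2 * (2 * k + 3)"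
    by (simp add: power2_eq_square algebra_simps)
  also have "\<dots> = 4 * ((2 * k + 1) * (2 * k + 3)) * (?c\<^sup>2 * (2 * k + 1))"
    unfolding c' by (simp add: power2_eq_square algebra_simps)
  also have "\<dots> \<le> 4 * (4 * (Suc k)\<^sup>2) * 16 ^ k"
  proof (rule mult_mono[OF mult_left_mono Suc.IH])
    show "(2 * k + 1) * (2 * k + 3) \<le> 4 * (Suc k)\<^sup>2" by (simp add: power2_eq_square algebra_simps)
  qed simp_all
  also have "\<dots> = (Suc k)\<^sup>2 * 16 ^ Suc k" by simp
  finally show ?case by (simp only: mult_le_cancel1) simp
qed simp

text \<open>For odd \<open>m\<close> this is the central bound itself; for even \<open>m\<close> the
  coefficient is half of the central one in row \<open>m\<close>.\<close>

lemma middle_binomial_bound: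
  assumes "m > 0"
  shows "((m - 1) choose (m div 2))\<^sup>2 * m \<le> 4 ^ (m - 1)"
proof (cases "even m")
  case False
  then obtain k where k: "m = 2 * k + 1" by (rule oddE)
  then show ?thesis using central_binomial_bound[of k] by (simp add: power_mult)
next
  case True
  then obtain b where "m = 2 * b" by auto
  then obtain k where k: "m = 2 * k + 2" using assms by (cases b) auto
  have "(2 * k + 1 choose k) = (2 * k + 1 choose Suc k)"
    using binomial_symmetric[of k "2 * k + 1"] by simp
  then have "(2 * Suc k choose Suc k) = 2 * (2 * k + 1 choose Suc k)" by simp
  then have "(2 * Suc k choose Suc k)\<^sup>2 * (2 * Suc k + 1) =
      4 * ((2 * k + 1 choose Suc k)\<^sup>2 * (2 * k + 3))"
    by (simp only: power_mult_distrib) (simp add: algebra_simps del: binomial_Suc_Suc)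
  then have "4 * ((2 * k + 1 choose Suc k)\<^sup>2 * (2 * k + 3)) \<le> 16 ^ Suc k"
    using central_binomial_bound[of "Suc k"] by (simp only:)
  then have "(2 * k + 1 choose Suc k)\<^sup>2 * (2 * k + 3) \<le> 4 * 16 ^ k"
    unfolding power_Suc by linarith
  moreover have "(2 * k + 1 choose Suc k)\<^sup>2 * (2 * k + 2) \<le> (2 * k + 1 choose Suc k)\<^sup>2 * (2 * k + 3)"
    by (intro mult_left_mono) auto
  ultimately show ?thesis by (simp add: k power_mult)
qed

lemma crit_asymp: "(\<lambda>m. 2 ^ (m - 2) - crit m) \<in> O(\<lambda>m. 2 ^ (m - 2) / sqrt (real m))"
proof (rule bigoI[where c = 1])
  have "norm (2 ^ (m - 2) - crit m) \<le> 1 * norm (2 ^ (m - 2) / sqrt (real m))" if m: "m \<ge> 2" for m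
  proof -
    define C where "C = (m - 1) choose (m div 2)"
    have C1: "1 \<le> real C" using m by (auto simp: C_def Suc_le_eq)
    have "(real C * sqrt (real m))\<^sup>2 = real (C\<^sup>2 * m)" by (simp add: power_mult_distrib)
    also have "\<dots> \<le> real (4 ^ (m - 1))"
      using middle_binomial_bound[of m] m unfolding C_def by (simp only: of_nat_le_iff)
    also have "\<dots> = (2 ^ (m - 1))\<^sup>2" by (simp add: power2_eq_square flip: power_mult_distrib)
    finally have "real C * sqrt (real m) \<le> 2 ^ (m - 1)" by (rule power2_le_imp_le) simp
    also have "(2::real) ^ (m - 1) = 2 * 2 ^ (m - 2)"
      using m by (metis Suc_diff_le diff_Suc_Suc numeral_2_eq_2 power_Suc One_nat_def)
    finally have b: "real C / 2 \<le> 2 ^ (m - 2) / sqrt (real m)" using m by (simp add: field_simps)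
    \<comment> \<open>For powers of 2 the gap is \<open>(C - 1) / 2\<close>, so \<open>C1\<close>
      keeps it nonnegative.\<close>
    have "0 \<le> 2 ^ (m - 2) - crit m \<and> 2 ^ (m - 2) - crit m \<le> real C / 2"
    proof (cases "even m")
      case True
      then show ?thesis using C1 by (simp add: crit_def C_def)
    next
      case False
      then have "(m - 1) div 2 = m div 2" by (auto elim: oddE)
      then show ?thesis using False C1 by (simp add: crit_def C_def)
    qed
    moreover have "0 \<le> 2 ^ (m - 2) / sqrt (real m)" by simp
    ultimately show ?thesis unfolding real_norm_def mult_1 using b by linarith
  qed
  then show "\<forall>\<^sub>F m in at_top. norm (2 ^ (m - 2) - crit m) \<le> 1 * norm (2 ^ (m - 2) / sqrt (real m))"
    unfolding eventually_at_top_linorder by blast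
qed

section \<open>Chooser's strategy\<close>

definition pos :: "nat \<Rightarrow> (nat \<Rightarrow> real) \<Rightarrow> nat set" where
  "pos n v = {i. i < n \<and> v i = 1}"

lemma Vset_eq_chi: "v \<in> Vset n \<Longrightarrow> i < n \<Longrightarrow> v i = real_of_int (chi (pos n v) i)"
  by (auto simp: Vset_def pos_def chi_def)

definition flip :: "nat \<Rightarrow> (nat \<Rightarrow> real) \<Rightarrow> nat set set \<Rightarrow> nat set set" where
  "flip n v F = (let A = (if pos n v \<in> F then pos n v else {..<n} - pos n v)
                 in insert ({..<n} - A) (F - {A}))"

lemma compl_closed_Pow: "compl_closed n (Pow {..<n})"
  by (auto simp: compl_closed_def)

lemma transversal_Pow_card: "n > 0 \<Longrightarrow> transversal n (Pow {..<n}) F \<Longrightarrow> card F = 2 ^ (n - 1)"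
  using transversal_card[OF compl_closed_Pow, of n F] by (cases n) (auto simp: card_Pow)

lemma flip_transversal:
  assumes F: "transversal n (Pow {..<n}) F"
  shows "transversal n (Pow {..<n}) (flip n v F)"
    and "i < n \<Longrightarrow> (\<Sum>A\<in>flip n v F. chi A i) =
      (\<Sum>A\<in>F. chi A i) + 2 * (if pos n v \<in> F then - 1 else 1) * chi (pos n v) i"
proof -
  define A where "A = (if pos n v \<in> F then pos n v else {..<n} - pos n v)"
  have "pos n v \<subseteq> {..<n}" by (auto simp: pos_def)
  then have "pos n v \<in> F \<or> {..<n} - pos n v \<in> F" using F unfolding transversal_def by blast
  then have A: "A \<in> F" by (auto simp: A_def)
  have fl: "flip n v F = insert ({..<n} - A) (F - {A})" by (simp add: flip_def A_def Let_def)
  show "transversal n (Pow {..<n}) (flip n v F)"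
    unfolding fl by (rule transversal_flip(1)[OF compl_closed_Pow F A])
  show "(\<Sum>A\<in>flip n v F. chi A i) =
      (\<Sum>A\<in>F. chi A i) + 2 * (if pos n v \<in> F then - 1 else 1) * chi (pos n v) i" if "i < n"
  proof -
    have "(\<Sum>A\<in>flip n v F. chi A i) = (\<Sum>A\<in>F. chi A i) - 2 * chi A i"
      using transversal_flip(2)[OF compl_closed_Pow F A, of "\<lambda>A. chi A i"] chi_compl[OF that, of A]
      unfolding fl by linarith
    moreover have "chi A i = (if pos n v \<in> F then 1 else - 1) * chi (pos n v) i"
      using chi_compl[OF that] by (simp add: A_def)
    ultimately show ?thesis by simp
  qed
qed

lemma chooser_wins_of_transversal:
  assumes n: "n > 0" and F: "transversal n (Pow {..<n}) F"
    and M: "\<And>i. i < n \<Longrightarrow> 2 ^ (n - 1) - real_of_int (\<Sum>A\<in>F. chi A i) \<le> 2 * M"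
  shows "chooser_wins (Vset n) (Kset n M)"
proof -
  \<comment> \<open>A strategy sees only the history, so the current family is recomputed by
    replaying the flips. The sign mirrors the flip: replacing \<open>pos n v\<close> by its
    complement lowers the sum vector by \<open>2 * chi (pos n v)\<close>, twice a move with sign
    \<open>- 1\<close>.\<close>
  define st where "st h = fold (flip n) h F" for h
  define \<sigma> where "\<sigma> h v = (if pos n v \<in> st h then - 1 else 1 :: real)" for h v
  have "game_pos \<sigma> vs k \<in> Kset n M" if vs: "\<And>k. vs k \<in> Vset n" for vs k
  proof -
    have "transversal n (Pow {..<n}) (st (map vs [0..<k])) \<and>
      (\<forall>i<n. 2 * game_pos \<sigma> vs k i =
        real_of_int ((\<Sum>A\<in>st (map vs [0..<k]). chi A i) - (\<Sum>A\<in>F. chi A i)))"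
    proof (induction k)
      case 0
      then show ?case using F by (simp add: st_def)
    next
      case (Suc k)
      let ?S = "st (map vs [0..<k])"
      have S: "st (map vs [0..<Suc k]) = flip n (vs k) ?S" by (simp add: st_def)
      have T: "transversal n (Pow {..<n}) ?S" using Suc by blast
      show ?case unfolding S
      proof (intro conjI allI impI)
        show "transversal n (Pow {..<n}) (flip n (vs k) ?S)" by (rule flip_transversal(1)[OF T])
        fix i assume i: "i < n"
        have "2 * game_pos \<sigma> vs k i = real_of_int ((\<Sum>A\<in>?S. chi A i) - (\<Sum>A\<in>F. chi A i))"
          using Suc i by blast
        then show "2 * game_pos \<sigma> vs (Suc k) i =
            real_of_int ((\<Sum>A\<in>flip n (vs k) ?S. chi A i) - (\<Sum>A\<in>F. chi A i))"
          unfolding flip_transversal(2)[OF T i] using Vset_eq_chi[OF vs i]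
          by (simp add: \<sigma>_def algebra_simps)
      qed
    qed
    then have T: "transversal n (Pow {..<n}) (st (map vs [0..<k]))"
      and eq: "\<And>i. i < n \<Longrightarrow> 2 * game_pos \<sigma> vs k i =
        real_of_int ((\<Sum>A\<in>st (map vs [0..<k]). chi A i) - (\<Sum>A\<in>F. chi A i))" by auto
    have "game_pos \<sigma> vs k i \<le> M" if i: "i < n" for i
    proof -
      have "(\<Sum>A\<in>st (map vs [0..<k]). chi A i) \<le> (\<Sum>A\<in>st (map vs [0..<k]). 1)"
        by (intro sum_mono) (simp add: chi_def)
      also have "\<dots> = 2 ^ (n - 1)" using transversal_Pow_card[OF n T] by simp
      finally have "real_of_int (\<Sum>A\<in>st (map vs [0..<k]). chi A i) \<le> 2 ^ (n - 1)"
        by (metis of_int_le_iff of_int_numeral of_int_power)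
      then show ?thesis using eq[OF i] M[OF i] by simp
    qed
    then show ?thesis by (simp add: Kset_def)
  qed
  moreover have "\<sigma> h v \<in> {-1, 1}" for h v by (simp add: \<sigma>_def)
  ultimately show ?thesis unfolding chooser_wins_def by blast
qed

section \<open>Pusher's bound\<close>

text \<open>\<open>W\<close> may be infinite; integer values and the upper bound \<open>b\<close>
  make the maximum attained.\<close>

lemma maximizer_exists:
  fixes f :: "'a \<Rightarrow> int"
  assumes "x \<in> W" "\<And>z. z \<in> W \<Longrightarrow> f z \<le> b"
  shows "\<exists>z\<in>W. \<forall>y\<in>W. f y \<le> f z"
proof -
  obtain z where z: "z \<in> W" "\<And>y. y \<in> W \<Longrightarrow> nat (b - f z) \<le> nat (b - f y)"
    using ex_has_least_nat[of "\<lambda>z. z \<in> W" x "\<lambda>z. nat (b - f z)"] assms(1) by auto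
  have "f y \<le> f z" if "y \<in> W" for y
    using z(2)[OF that] assms(2)[OF that] assms(2)[OF z(1)] by linarith
  then show ?thesis using z(1) by auto
qed

text \<open>
  Increasing \<open>s\<close> makes the \<open>i\<close>-th coordinate of a maximizer larger. At each value of \<open>s\<close> where the
  weighting \<open>w + s e\<^sub>i\<close> is orthogonal to some \<open>chi A\<close>, the face of maximizers is invariant under one
  of \<open>\<plusminus>chi A\<close>, hence the coordinate jumps by at least 1 there; it never exceeds \<open>m\<close>. Distinct
  subset sums ensure that the jumps occur at distinct values of \<open>s\<close>.
\<close>

lemma maximizer_coordinate_bound:
  fixes W :: "(nat \<Rightarrow> int) set" and w :: "nat \<Rightarrow> int"
  assumes bd: "\<And>z j. z \<in> W \<Longrightarrow> j < n \<Longrightarrow> z j \<le> m"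
    and inv: "\<And>z A. z \<in> W \<Longrightarrow> A \<subseteq> {..<n} \<Longrightarrow>
                \<exists>z'\<in>W. \<exists>e\<in>{-1, 1}. \<forall>j<n. z' j = z j + e * chi A j"
    and w0: "\<And>j. 0 \<le> w j"
    and inj: "inj_on (\<lambda>A. sum w A) (Pow {..<n})"
    and i: "i < n" and s: "0 \<le> s" and z: "z \<in> W"
    and max: "\<And>y. y \<in> W \<Longrightarrow> (\<Sum>j<n. w j * y j) + s * y i \<le> (\<Sum>j<n. w j * z j) + s * z i"
  shows "z i \<le> m - int (card {A. A \<subseteq> {..<n} \<and> i \<in> A \<and> s < sum w ({..<n} - A) - sum w A})"
  using s z max
proof (induction "card {A. A \<subseteq> {..<n} \<and> i \<in> A \<and> s < sum w ({..<n} - A) - sum w A}" arbitrary: s z)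
  case 0
  have "z i \<le> m" using bd[OF 0(3) i] .
  then show ?case unfolding 0(1)[symmetric] by simp
next
  case (Suc k)
  define D where "D A = sum w ({..<n} - A) - sum w A" for A
  define C where "C s = {A. A \<subseteq> {..<n} \<and> i \<in> A \<and> s < D A}" for s
  have Deq: "D A = sum w {..<n} - 2 * sum w A" if "A \<subseteq> {..<n}" for A
    using that by (simp add: D_def sum_diff)
  have fin: "finite (C s)" by (simp add: C_def)
  have ck: "Suc k = card (C s)" using Suc.hyps(2) by (simp add: C_def D_def)
  then have "C s \<noteq> {}" by auto
  \<comment> \<open>\<open>D A\<close> is the value of \<open>s\<close> at which the weighting
    becomes orthogonal to \<open>chi A\<close>; the chosen \<open>A\<close> is the first one met
    beyond the current \<open>s\<close>.\<close>
  then obtain A where A: "A \<in> C s" and Amin: "\<And>B. B \<in> C s \<Longrightarrow> D A \<le> D B"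
    using arg_min_if_finite[OF fin, of D] by (metis not_le)
  have As: "A \<subseteq> {..<n}" "i \<in> A" "s < D A" using A by (auto simp: C_def)
  have DA0: "0 \<le> D A" using As Suc.prems(1) by linarith
  have "C (D A) = C s - {A}"
  proof -
    have "D A < D B" if "B \<in> C s" "B \<noteq> A" for B
    proof -
      have "B \<subseteq> {..<n}" using that by (auto simp: C_def)
      then have "sum w B \<noteq> sum w A" using inj As that by (auto dest: inj_onD)
      then have "D B \<noteq> D A" using Deq As \<open>B \<subseteq> _\<close> by simp
      then show ?thesis using Amin[OF that(1)] by simp
    qed
    then show ?thesis using As by (auto simp: C_def)
  qed
  then have k: "k = card (C (D A))" using ck A fin by simp
  define g where "g y = (\<Sum>j<n. w j * y j) + D A * y i" for y :: "nat \<Rightarrow> int"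
  have "\<exists>z\<in>W. \<forall>y\<in>W. g y \<le> g z"
  proof (rule maximizer_exists[OF Suc.prems(2)])
    fix y assume y: "y \<in> W"
    show "g y \<le> (\<Sum>j<n. w j * m) + D A * m"
      unfolding g_def using bd[OF y] w0 DA0 i
      by (intro add_mono sum_mono mult_left_mono) auto
  qed
  then obtain y where y: "y \<in> W" "\<And>x. x \<in> W \<Longrightarrow> g x \<le> g y" by auto
  obtain y' e where y': "y' \<in> W" "e \<in> {-1, 1}" "\<And>j. j < n \<Longrightarrow> y' j = y j + e * chi A j"
    using inv[OF y(1) As(1)] by blast
  have "g y' = g y + e * ((\<Sum>j<n. w j * chi A j) + D A * chi A i)"
    using y'(3) i by (simp add: g_def algebra_simps sum.distrib sum_distrib_left)
  also have "(\<Sum>j<n. w j * chi A j) = - D A"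
  proof -
    have "(\<Sum>j<n. w j * chi A j) = (\<Sum>j\<in>A. w j * chi A j) + (\<Sum>j\<in>{..<n} - A. w j * chi A j)"
      using As(1) by (simp add: sum.subset_diff add.commute)
    also have "(\<Sum>j\<in>A. w j * chi A j) = sum w A" by (simp add: chi_def)
    also have "(\<Sum>j\<in>{..<n} - A. w j * chi A j) = - sum w ({..<n} - A)"
      by (simp add: chi_def sum_negf[symmetric])
    finally show ?thesis by (simp add: D_def)
  qed
  finally have gy': "g y' = g y" using As by (simp add: chi_def)
  \<comment> \<open>The induction hypothesis covers every maximizer of \<open>g\<close>, in
    particular both \<open>y\<close> and \<open>y'\<close>. Their \<open>i\<close>-th coordinates
    differ by 1, so the smaller one gains the extra unit.\<close>
  have "x i \<le> m - int k" if "x \<in> W" "g x = g y" for x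
    using Suc.hyps(1)[of "D A" x] k DA0 that y(2) by (simp add: C_def D_def g_def)
  then have "y i \<le> m - int k" "y' i \<le> m - int k" using y y' gy' by auto
  moreover have "y' i = y i + 1 \<or> y' i = y i - 1" using y'(2,3) i As by (auto simp: chi_def)
  ultimately have "y i \<le> m - int (Suc k) \<or> y' i \<le> m - int (Suc k)" by linarith
  then obtain x where x: "x \<in> W" "g x = g y" "x i \<le> m - int (Suc k)"
    using y(1) y'(1) gy' by blast
  \<comment> \<open>Adding the optimality of \<open>x\<close> at \<open>D A\<close> to that of
    \<open>z\<close> at \<open>s\<close> cancels the \<open>w\<close>-terms, which leaves
    monotonicity of the \<open>i\<close>-th coordinate.\<close>
  have "g z \<le> g x" using y x Suc.prems(2) by auto
  moreover have "(\<Sum>j<n. w j * x j) + s * x i \<le> (\<Sum>j<n. w j * z j) + s * z i"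
    using Suc.prems(3) x(1) by auto
  ultimately have "(D A - s) * z i \<le> (D A - s) * x i" by (simp add: g_def algebra_simps)
  then have "z i \<le> x i" using As(3) by simp
  then show ?case using x(3) ck by (simp add: C_def D_def)
qed

text \<open>The powers of 2 encode the subset, and \<open>L\<close> exceeds every sum of them, so
  cardinality decides first and the encoding breaks ties. For large \<open>L\<close> the weight
  approaches the all-ones direction.\<close>

lemma subset_sum_weights:
  fixes L :: int
  assumes L: "2 ^ n \<le> L"
  defines "w \<equiv> \<lambda>j. L + 2 ^ j"
  shows "inj_on (\<lambda>A. sum w A) (Pow {..<n})"
    and "A \<subseteq> {..<n} \<Longrightarrow> B \<subseteq> {..<n} \<Longrightarrow> card A < card B \<Longrightarrow> sum w A < sum w B"
    and "A \<subseteq> {..<n} \<Longrightarrow> L * int (card A) \<le> sum w A"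
    and "sum w {..<n} \<le> L * int n + 2 ^ n"
proof -
  define e where "e A = (\<Sum>j\<in>A. 2 ^ j :: int)" for A
  have sw: "sum w A = L * int (card A) + e A" for A
    by (simp add: w_def e_def sum.distrib mult.commute)
  have e0: "0 \<le> e A" for A by (simp add: e_def sum_nonneg)
  have "(\<Sum>j<n. 2 ^ j :: int) = 2 ^ n - 1" by (induction n) auto
  then have en: "e {..<n} < 2 ^ n" by (simp add: e_def)
  have eL: "e A < L" if "A \<subseteq> {..<n}" for A
  proof -
    have "e A \<le> e {..<n}" unfolding e_def using that by (intro sum_mono2) auto
    then show ?thesis using en L by simp
  qed
  show less: "sum w A < sum w B" if "A \<subseteq> {..<n}" "B \<subseteq> {..<n}" "card A < card B" for A B
  proof -
    have L0: "0 \<le> L" using eL[of "{}"] by (simp add: e_def)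
    have "sum w A < L * (int (card A) + 1)" using eL[OF that(1)] by (simp add: sw algebra_simps)
    also have "\<dots> \<le> L * int (card B)" using that L0 by (intro mult_left_mono) auto
    also have "\<dots> \<le> sum w B" using e0 by (simp add: sw)
    finally show ?thesis .
  qed
  show "inj_on (\<lambda>A. sum w A) (Pow {..<n})"
  proof (intro inj_onI)
    fix A B assume AB: "A \<in> Pow {..<n}" "B \<in> Pow {..<n}" "sum w A = sum w B"
    then have "card A = card B" using less[of A B] less[of B A] by (auto intro: linorder_cases)
    then have "int (set_encode A) = int (set_encode B)"
      using AB(3) by (simp add: sw e_def set_encode_def)
    moreover have "finite A" "finite B" using AB finite_subset by auto
    ultimately show "A = B" by (simp add: set_encode_eq)
  qed
  show "L * int (card A) \<le> sum w A" if "A \<subseteq> {..<n}" using e0 by (simp add: sw)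
  show "sum w {..<n} \<le> L * int n + 2 ^ n" using en by (simp add: sw)
qed

text \<open>\<open>n - 2 * card A\<close> vanishes on half-size sets, so only the sets below half
  size matter; complementation turns them into the majority sets, whose coordinate sums are
  known.\<close>

lemma sum_card_light:
  assumes n: "n > 0" and T: "transversal n (Pow {..<n}) G"
    and le: "\<And>A. A \<in> G \<Longrightarrow> 2 * card A \<le> n"
    and mem: "\<And>A. A \<subseteq> {..<n} \<Longrightarrow> 2 * card A < n \<Longrightarrow> A \<in> G"
  shows "2 * (\<Sum>A\<in>G. int (card A)) = int n * (2 ^ (n - 1) - int ((n - 1) choose (n div 2)))"
proof -
  let ?c = "\<lambda>A. {..<n} - A"
  let ?S = "{A. A \<subseteq> {..<n} \<and> 2 * card A < n}" and ?B = "{A. A \<subseteq> {..<n} \<and> n < 2 * card A}"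
  have sub: "A \<subseteq> {..<n}" if "A \<in> G" for A using that T by (auto simp: transversal_def)
  have finG: "finite G" using compl_closed_Pow T by (rule transversal_finite)
  have "(\<Sum>A\<in>G. int n - 2 * int (card A)) = (\<Sum>A\<in>?S. int n - 2 * int (card A))"
  proof (intro sum.mono_neutral_right ballI)
    fix A assume A: "A \<in> G - ?S"
    then show "int n - 2 * int (card A) = 0" using le[of A] sub[of A] by auto
  qed (use finG mem in auto)
  also have "\<dots> = (\<Sum>A\<in>?B. 2 * int (card A) - int n)"
  proof (rule sum.reindex_bij_witness[where i = ?c and j = ?c])
    fix A assume A: "A \<in> ?S"
    then have "card (?c A) = n - card A" "card A \<le> n"
      using card_compl[of A n] card_mono[of "{..<n}" A] by auto
    then show "?c A \<in> ?B" "2 * int (card (?c A)) - int n = int n - 2 * int (card A)" using A by auto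
    show "?c (?c A) = A" using A by (auto intro: double_compl)
  next
    fix A assume A: "A \<in> ?B"
    then have "card (?c A) = n - card A" "card A \<le> n"
      using card_compl[of A n] card_mono[of "{..<n}" A] by auto
    then show "?c A \<in> ?S" using A by auto
    show "?c (?c A) = A" using A by (auto intro: double_compl)
  qed
  also have "\<dots> = (\<Sum>A\<in>?B. \<Sum>i<n. chi A i)" by (intro sum.cong) (auto simp: sum_chi)
  also have "\<dots> = (\<Sum>i<n. \<Sum>A\<in>?B. chi A i)" by (rule sum.swap)
  also have "\<dots> = int n * int ((n - 1) choose (n div 2))" by (simp add: sum_chi_majority)
  finally have "(\<Sum>A\<in>G. int n - 2 * int (card A)) = int n * int ((n - 1) choose (n div 2))" .
  moreover have "(\<Sum>A\<in>G. int n - 2 * int (card A)) = int n * 2 ^ (n - 1) - 2 * (\<Sum>A\<in>G. int (card A))"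
    using transversal_Pow_card[OF n T] by (simp add: sum_subtractf sum_distrib_left)
  ultimately show ?thesis by (simp add: algebra_simps)
qed

lemma invariant_set_bound:
  fixes W :: "(nat \<Rightarrow> int) set"
  assumes n: "n > 0" and zero: "(\<lambda>_. 0) \<in> W"
    and bd: "\<And>z j. z \<in> W \<Longrightarrow> j < n \<Longrightarrow> z j \<le> m"
    and inv: "\<And>z A. z \<in> W \<Longrightarrow> A \<subseteq> {..<n} \<Longrightarrow>
                \<exists>z'\<in>W. \<exists>e\<in>{-1, 1}. \<forall>j<n. z' j = z j + e * chi A j"
  shows "2 ^ (n - 1) - int ((n - 1) choose (n div 2)) \<le> 2 * m"
proof -
  define C where "C = 2 ^ (n - 1) - int ((n - 1) choose (n div 2))"
  have m0: "0 \<le> m" using bd[OF zero n] .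
  \<comment> \<open>The bound seen by the weight with parameter \<open>L\<close>; the term
    \<open>2 ^ n\<close> becomes negligible as \<open>L\<close> grows.\<close>
  have key: "L * (int n * C) \<le> 2 * m * (L * int n + 2 ^ n)" if L: "2 ^ n \<le> L" for L :: int
  proof -
    define w where "w j = L + 2 ^ j" for j
    note w = subset_sum_weights[OF L, folded w_def]
    have L0: "0 \<le> L" using L by (meson order_trans zero_le_numeral zero_le_power)
    have w0: "0 \<le> w j" for j using L0 by (simp add: w_def)
    let ?c = "\<lambda>A. {..<n} - A"
    \<comment> \<open>The lighter set of each complementary pair. Those containing \<open>i\<close>
      are exactly the sets whose jumps lie ahead when the weight moves from \<open>w\<close> in
      direction \<open>i\<close>.\<close>
    define G where "G = {A. A \<subseteq> {..<n} \<and> sum w A < sum w (?c A)}"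
    have T: "transversal n (Pow {..<n}) G"
      unfolding transversal_def
    proof (intro conjI ballI)
      show "G \<subseteq> Pow {..<n}" by (auto simp: G_def)
      fix A assume A: "A \<in> Pow {..<n}"
      have "A \<noteq> ?c A" using n by (auto simp: set_eq_iff)
      then have "sum w A \<noteq> sum w (?c A)" using w(1) A by (auto dest: inj_onD)
      then show "A \<in> G \<longleftrightarrow> ?c A \<notin> G" using A double_compl[of A n] by (auto simp: G_def)
    qed
    have finG: "finite G" by (simp add: G_def)
    have cc: "card (?c A) = n - card A" "card A \<le> n" if "A \<subseteq> {..<n}" for A
      using that card_compl[of A n] card_mono[of "{..<n}" A] by auto
    have cardG: "2 * (\<Sum>A\<in>G. int (card A)) = int n * C" unfolding C_def
    proof (rule sum_card_light[OF n T])
      fix A assume "A \<in> G"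
      then show "2 * card A \<le> n" using w(2)[of "?c A" A] cc[of A] by (force simp: G_def)
    next
      fix A assume "A \<subseteq> {..<n}" "2 * card A < n"
      then show "A \<in> G" using w(2)[of A "?c A"] cc[of A] by (auto simp: G_def)
    qed
    have "\<exists>z\<in>W. \<forall>y\<in>W. (\<Sum>j<n. w j * y j) \<le> (\<Sum>j<n. w j * z j)"
    proof (rule maximizer_exists[OF zero])
      fix y assume "y \<in> W"
      then show "(\<Sum>j<n. w j * y j) \<le> (\<Sum>j<n. w j * m)"
        using bd w0 by (intro sum_mono mult_left_mono) auto
    qed
    then obtain z where z: "z \<in> W" "\<And>y. y \<in> W \<Longrightarrow> (\<Sum>j<n. w j * y j) \<le> (\<Sum>j<n. w j * z j)"
      by blast
    have zi: "z i \<le> m - int (card {A\<in>G. i \<in> A})" if i: "i < n" for i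
    proof -
      have "{A. A \<subseteq> {..<n} \<and> i \<in> A \<and> 0 < sum w (?c A) - sum w A} = {A\<in>G. i \<in> A}"
        by (auto simp: G_def)
      moreover have "z i \<le> m - int (card {A. A \<subseteq> {..<n} \<and> i \<in> A \<and> 0 < sum w (?c A) - sum w A})"
        by (rule maximizer_coordinate_bound[where W = W])
          (fact bd inv w0 w(1) i order_refl z(1) | use z(2) in simp)+
      ultimately show ?thesis by simp
    qed
    \<comment> \<open>The origin lies in \<open>W\<close>, so the maximum is nonnegative. Inserting
      the coordinate bounds and exchanging the sums bounds the total weight of
      \<open>G\<close>.\<close>
    have "0 \<le> (\<Sum>j<n. w j * z j)" using z(2)[OF zero] by simp
    also have "\<dots> \<le> (\<Sum>j<n. w j * (m - int (card {A\<in>G. j \<in> A})))"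
      using zi w0 by (intro sum_mono mult_left_mono) auto
    also have "\<dots> = m * sum w {..<n} - (\<Sum>j<n. w j * int (card {A\<in>G. j \<in> A}))"
      by (simp add: algebra_simps sum_subtractf sum_distrib_left)
    also have "(\<Sum>j<n. w j * int (card {A\<in>G. j \<in> A})) = (\<Sum>j<n. \<Sum>A\<in>G. if j \<in> A then w j else 0)"
      using finG by (simp add: sum.If_cases Int_def mult.commute)
    also have "\<dots> = (\<Sum>A\<in>G. \<Sum>j<n. if j \<in> A then w j else 0)" by (rule sum.swap)
    also have "\<dots> = (\<Sum>A\<in>G. sum w A)"
    proof (rule sum.cong[OF refl])
      fix A assume "A \<in> G"
      then have "{..<n} \<inter> A = A" by (auto simp: G_def)
      then show "(\<Sum>j<n. if j \<in> A then w j else 0) = sum w A" by (simp add: sum.If_cases)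
    qed
    finally have "(\<Sum>A\<in>G. sum w A) \<le> m * sum w {..<n}" by simp
    moreover have "(\<Sum>A\<in>G. L * int (card A)) \<le> (\<Sum>A\<in>G. sum w A)"
      using w(3) by (intro sum_mono) (auto simp: G_def)
    moreover have "m * sum w {..<n} \<le> m * (L * int n + 2 ^ n)"
      using w(4) m0 by (intro mult_left_mono) auto
    moreover have "(\<Sum>A\<in>G. L * int (card A)) * 2 = L * (int n * C)"
      unfolding cardG[symmetric] sum_distrib_left[symmetric] by simp
    ultimately show ?thesis by linarith
  qed
  have "C \<le> 2 * m"
  proof (rule ccontr)
    assume "\<not> C \<le> 2 * m"
    then have "2 * m + 1 \<le> C" by simp
    \<comment> \<open>If \<open>C \<ge> 2 * m + 1\<close>, then \<open>key\<close> yields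
      \<open>L * int n \<le> 2 * m * 2 ^ n\<close>, which this \<open>L\<close> is just large enough
      to violate.\<close>
    define L where "L = (2 * m + 1) * (2 :: int) ^ n"
    have L: "2 ^ n \<le> L" using m0 by (simp add: L_def mult_le_cancel_right1)
    then have L0: "0 \<le> L" by (meson order_trans zero_le_numeral zero_le_power)
    have "L * int n * (2 * m + 1) \<le> L * int n * C"
      using \<open>2 * m + 1 \<le> C\<close> L0 by (intro mult_left_mono) auto
    also have "\<dots> \<le> 2 * m * (L * int n + 2 ^ n)" using key[OF L] by (simp add: mult.assoc)
    finally have "L * int n \<le> 2 * m * 2 ^ n" by (simp add: algebra_simps)
    moreover have "L * 1 \<le> L * int n" using n L0 by (intro mult_left_mono) auto
    ultimately have "L \<le> 2 * m * 2 ^ n" by simp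
    then show False by (simp add: L_def algebra_simps)
  qed
  then show ?thesis by (simp add: C_def)
qed

section \<open>Positions reachable under a winning strategy\<close>

lemma game_pos_cong: "(\<And>j. j < k \<Longrightarrow> vs j = vs' j) \<Longrightarrow> game_pos \<sigma> vs k = game_pos \<sigma> vs' k"
proof (induction k)
  case (Suc k)
  have "map vs [0..<k] = map vs' [0..<k]" using Suc.prems by simp
  moreover have "game_pos \<sigma> vs k = game_pos \<sigma> vs' k" "vs k = vs' k" using Suc by auto
  ultimately show ?case by (simp only: game_pos.simps)
qed simp

lemma chooser_wins_bound:
  assumes n: "n > 0" and win: "chooser_wins (Vset n) (Kset n M)"
  shows "2 ^ (n - 1) - int ((n - 1) choose (n div 2)) \<le> 2 * \<lfloor>M\<rfloor>"
proof -
  obtain \<sigma> where sig: "\<And>h v. \<sigma> h v \<in> {-1, 1}"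
    and keep: "\<And>vs k. (\<And>k. vs k \<in> Vset n) \<Longrightarrow> game_pos \<sigma> vs k \<in> Kset n M"
    using win unfolding chooser_wins_def by blast
  \<comment> \<open>Reachable positions have integer entries, so \<open>M\<close> may be replaced by
    its floor. Entries from index \<open>n\<close> on are left free.\<close>
  define W where "W = {z. \<exists>vs k. (\<forall>k. vs k \<in> Vset n) \<and>
    (\<forall>i<n. game_pos \<sigma> vs k i = real_of_int (z i))}"
  define vec where "vec A i = (if i < n then real_of_int (chi A i) else 0)" for A i
  have vecV: "vec A \<in> Vset n" if "0 \<in> A" for A
    using that n by (auto simp: Vset_def vec_def chi_def)
  show ?thesis
  proof (rule invariant_set_bound[OF n])
    show "(\<lambda>_. 0) \<in> W" unfolding W_def
      using vecV[of "{0}"] by (auto intro!: exI[of _ "\<lambda>_. vec {0}"] exI[of _ 0])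
  next
    fix z j assume "z \<in> W" "j < n"
    then obtain vs k where "\<And>k. vs k \<in> Vset n" "game_pos \<sigma> vs k j = real_of_int (z j)"
      unfolding W_def by blast
    then have "real_of_int (z j) \<le> M" using keep[of vs k] \<open>j < n\<close> by (auto simp: Kset_def)
    then show "z j \<le> \<lfloor>M\<rfloor>" by (simp add: le_floor_iff)
  next
    fix z A assume z: "z \<in> W" and A: "A \<subseteq> {..<n}"
    \<comment> \<open>Only sets containing 0 are offers, because vectors in \<open>Vset n\<close>
      start with 1. The remaining sets follow from their complements by reversing the sign
      \<open>e\<close>.\<close>
    have step: "\<exists>z'\<in>W. \<exists>e\<in>{-1, 1}. \<forall>j<n. z' j = z j + e * chi A j" if "0 \<in> A" for A
    proof -
      obtain vs k where vs: "\<And>k. vs k \<in> Vset n" and eq: "\<And>i. i < n \<Longrightarrow> game_pos \<sigma> vs k i = real_of_int (z i)"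
        using z unfolding W_def by blast
      define vs' where "vs' = vs(k := vec A)"
      define e where "e = (if \<sigma> (map vs' [0..<k]) (vec A) = 1 then 1 else - 1 :: int)"
      have e: "\<sigma> (map vs' [0..<k]) (vec A) = real_of_int e"
        using sig[of "map vs' [0..<k]" "vec A"] by (auto simp: e_def)
      have "game_pos \<sigma> vs' k = game_pos \<sigma> vs k" by (rule game_pos_cong) (simp add: vs'_def)
      moreover have "vs' k = vec A" by (simp add: vs'_def)
      ultimately have "game_pos \<sigma> vs' (Suc k) i = real_of_int (z i + e * chi A i)" if "i < n" for i
        using eq e that by (simp add: vec_def)
      moreover have "vs' l \<in> Vset n" for l using vs vecV that by (simp add: vs'_def)
      ultimately have "(\<lambda>i. z i + e * chi A i) \<in> W" unfolding W_def by blast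
      moreover have "e \<in> {-1, 1}" by (simp add: e_def)
      ultimately show ?thesis
        by (intro bexI[of _ "\<lambda>i. z i + e * chi A i"] bexI[of _ e]) simp_all
    qed
    show "\<exists>z'\<in>W. \<exists>e\<in>{-1, 1}. \<forall>j<n. z' j = z j + e * chi A j"
    proof (cases "0 \<in> A")
      case False
      then have "0 \<in> {..<n} - A" using n by simp
      then obtain z' e where z': "z' \<in> W" "e \<in> {-1, 1}"
        "\<And>j. j < n \<Longrightarrow> z' j = z j + e * chi ({..<n} - A) j" using step[of "{..<n} - A"] by blast
      have "\<forall>j<n. z' j = z j + (- e) * chi A j" using z'(3) by (simp add: chi_compl)
      moreover have "- e \<in> {-1, 1}" using z'(2) by auto
      ultimately show ?thesis by (intro bexI[OF _ z'(1)] bexI[of _ "- e"])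
    qed (rule step)
  qed
qed

section \<open>The critical value\<close>

lemma chooser_wins_iff:
  assumes n: "n > 1"
  shows "chooser_wins (Vset n) (Kset n M) \<longleftrightarrow>
    2 ^ (n - 2) - real ((n - 1) choose (n div 2)) / 2 + (if \<exists>k. n = 2 ^ k then 1 / 2 else 0) \<le> M"
proof -
  define C where "C = (n - 1) choose (n div 2)"
  define p where "p = (if \<exists>k. n = 2 ^ k then 1 else 0 :: nat)"
  \<comment> \<open>Kept generic in the ring, since it is applied both to integers and to
    reals.\<close>
  have pw: "2 ^ (n - 1) = 2 * (2 :: 'a :: comm_ring_1) ^ (n - 2)"
    using n by (metis Suc_diff_Suc numeral_2_eq_2 power_Suc One_nat_def)
  have p: "p = (if even n then C mod 2 else 0)"
  proof (cases "even n")
    case True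
    then obtain m where m: "n = 2 * m" by auto
    then show ?thesis using odd_binomial_iff_power_of_2[of m] n
      by (auto simp: p_def C_def odd_iff_mod_2_eq_one even_iff_mod_2_eq_zero)
  next
    case False
    have "n \<noteq> 2 ^ k" for k using False n by (cases k) auto
    then show ?thesis using False by (simp add: p_def)
  qed
  have "chooser_wins (Vset n) (Kset n M) \<longleftrightarrow> 2 ^ (n - 1) - real C + real p \<le> 2 * M"
  proof
    assume "chooser_wins (Vset n) (Kset n M)"
    then have le: "2 ^ (n - 1) - int C \<le> 2 * \<lfloor>M\<rfloor>" using chooser_wins_bound n by (simp add: C_def)
    \<comment> \<open>If \<open>p = 1\<close>, the left side of \<open>le\<close> is odd and the
      right side even, so the inequality is strict and gains a unit.\<close>
    have "2 ^ (n - 1) - int C + int p \<le> 2 * \<lfloor>M\<rfloor>"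
    proof (cases "p = 0")
      case False
      then have "odd C" "p = 1" using p by (auto split: if_splits simp: mod_2_eq_odd)
      have "odd (2 ^ (n - 1) - int C)" unfolding pw using \<open>odd C\<close> by simp
      then have "2 ^ (n - 1) - int C \<noteq> 2 * \<lfloor>M\<rfloor>" by (metis dvd_triv_left)
      then show ?thesis using le \<open>p = 1\<close> by simp
    qed (use le in simp)
    then have "real_of_int (2 ^ (n - 1) - int C + int p) \<le> real_of_int (2 * \<lfloor>M\<rfloor>)"
      by (simp only: of_int_le_iff)
    then show "2 ^ (n - 1) - real C + real p \<le> 2 * M" using of_int_floor_le[of M] by (simp, linarith)
  next
    assume M: "2 ^ (n - 1) - real C + real p \<le> 2 * M"
    have "(if even n then int (C mod 2) else 0) = int p" using p by simp
    then obtain F where F: "transversal n (Pow {..<n}) F"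
      and d: "\<And>i. i < n \<Longrightarrow> int C - int p \<le> (\<Sum>A\<in>F. chi A i)"
      using good_transversal[OF n, folded C_def] by metis
    show "chooser_wins (Vset n) (Kset n M)"
    proof (rule chooser_wins_of_transversal[OF _ F])
      fix i assume "i < n"
      then have "real_of_int (int C - int p) \<le> real_of_int (\<Sum>A\<in>F. chi A i)"
        using d by (simp only: of_int_le_iff)
      then show "2 ^ (n - 1) - real_of_int (\<Sum>A\<in>F. chi A i) \<le> 2 * M" using M by simp
    qed (use n in simp)
  qed
  then show ?thesis unfolding pw by (auto simp: C_def p_def)
qed

theorem theorem1p4:
  fixes n :: nat and M :: real
  assumes "n > 1"
  shows "(odd n \<longrightarrow>
            (chooser_wins (Vset n) (Kset n M) \<longleftrightarrow>
             M \<ge> 2 ^ (n - 2) - (n - 1 choose ((n - 1) div 2)) / 2))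
       \<and> (even n \<and> \<not> (\<exists>k. n = 2 ^ k) \<longrightarrow>
            (chooser_wins (Vset n) (Kset n M) \<longleftrightarrow>
             M \<ge> 2 ^ (n - 2) - (n - 1 choose (n div 2)) / 2))
       \<and> ((\<exists>k. n = 2 ^ k) \<longrightarrow>
            (chooser_wins (Vset n) (Kset n M) \<longleftrightarrow>
             M \<ge> 2 ^ (n - 2) - (n - 1 choose (n div 2)) / 2 + 1 / 2))
       \<and> (\<lambda>m. 2 ^ (m - 2) - crit m) \<in> O(\<lambda>m. 2 ^ (m - 2) / sqrt (real m))"
proof (intro conjI impI)
  assume odd: "odd n"
  then have "(n - 1) div 2 = n div 2" by (auto elim: oddE)
  moreover have "n \<noteq> 2 ^ k" for k using odd assms by (cases k) auto
  ultimately show "chooser_wins (Vset n) (Kset n M) \<longleftrightarrow>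
      M \<ge> 2 ^ (n - 2) - (n - 1 choose ((n - 1) div 2)) / 2"
    using chooser_wins_iff[OF assms] by simp
qed (use chooser_wins_iff[OF assms] crit_asymp in auto)

end
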